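(* Let $U \subseteq \mathbb{R}^K$ be open and convex, and let $Q : U \to \mathbb{R}^K$ be differentiable with Jacobian matrix weakly quasi-definite at every point of $U$. Consider, for a point $u \in U$, the conditions: (a) For any $\tilde{u} \in U$ with $\tilde{u} \neq u$, $Q(u) \neq Q(\tilde{u})$. (b) $Q$ is locally injective at $u$, i.e. there is a neighborhood $N \subseteq U$ of $u$ such that the restriction of $Q$ to $N$ is injective. (c) The only line segment in $U$ that contains $u$ and over which $Q$ is constant is the point $u$. (d) There is no nonzero vector $v \in \mathbb{R}^K$ such that for all $\lambda \in [0,1]$ satisfying $u + \lambda v \in U$, $Q'(u + \lambda v, v)$ is the zero vector. Then, for each choice of one of the conditions (a), (b), (c), (d), the following are equivalent: (i) $Q$ is injective. (ii) The chosen condition holds at every $u \in U$.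
   Context: A real $K \times K$ matrix $B$ is weakly quasi-definite if $(B + B')/2$ is positive semi-definite, i.e. $\lambda' \frac{B + B'}{2} \lambda \geq 0$ for every $\lambda \in \mathbb{R}^K$, where $'$ on matrices and vectors denotes transpose. A line segment is a set $\{(1-\alpha) a + \alpha b : \alpha \in [0,1]\}$ with $a, b \in \mathbb{R}^K$ (possibly $a=b$, a point). The directional derivative of $Q$ at $w$ in direction $v$ is $Q'(w, v) = \lim_{\lambda \downarrow 0} \frac{Q(w + \lambda v) - Q(w)}{\lambda}$, whenever this limit exists. Differentiable means differentiable at every point (the derivative is not assumed continuous). *)

theory Defs
  imports "HOL-Analysis.Analysis"
begin

definition weakly_quasi_definite :: "real^'k^'k \<Rightarrow> bool" where
  "weakly_quasi_definite B \<longleftrightarrow>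
     (\<forall>l :: real^'k. l \<bullet> (((1/2) *\<^sub>R (B + transpose B)) *v l) \<ge> 0)"

text \<open>One-sided directional derivative: the limit exists and equals \<open>d\<close>.  For \<open>w\<close> in an open
  set \<open>U\<close> it depends only on the values of \<open>Q\<close> on \<open>U\<close>.\<close>

definition has_directional_derivative ::
    "(real^'k \<Rightarrow> real^'k) \<Rightarrow> real^'k \<Rightarrow> real^'k \<Rightarrow> real^'k \<Rightarrow> bool" where
  "has_directional_derivative Q d w v \<longleftrightarrow>
     ((\<lambda>t. (Q (w + t *\<^sub>R v) - Q w) /\<^sub>R t) \<longlongrightarrow> d) (at_right 0)"

definition uniquely_attained_at ::
    "(real^'k) set \<Rightarrow> (real^'k \<Rightarrow> real^'k) \<Rightarrow> real^'k \<Rightarrow> bool" where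
  "uniquely_attained_at U Q u \<longleftrightarrow> (\<forall>u'\<in>U. u' \<noteq> u \<longrightarrow> Q u \<noteq> Q u')"

definition locally_injective_at ::
    "(real^'k) set \<Rightarrow> (real^'k \<Rightarrow> real^'k) \<Rightarrow> real^'k \<Rightarrow> bool" where
  "locally_injective_at U Q u \<longleftrightarrow> (\<exists>N\<subseteq>U. u \<in> interior N \<and> inj_on Q N)"

text \<open>\<open>closed_segment a b\<close> includes the degenerate segment \<open>a = b\<close>.\<close>

definition no_constant_segment_at ::
    "(real^'k) set \<Rightarrow> (real^'k \<Rightarrow> real^'k) \<Rightarrow> real^'k \<Rightarrow> bool" where
  "no_constant_segment_at U Q u \<longleftrightarrow>
     (\<forall>a b. closed_segment a b \<subseteq> U \<and> u \<in> closed_segment a b \<and> Q constant_on closed_segment a b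
        \<longrightarrow> closed_segment a b = {u})"

definition no_null_direction_at ::
    "(real^'k) set \<Rightarrow> (real^'k \<Rightarrow> real^'k) \<Rightarrow> real^'k \<Rightarrow> bool" where
  "no_null_direction_at U Q u \<longleftrightarrow>
     \<not> (\<exists>v. v \<noteq> 0 \<and>
          (\<forall>l\<in>{0..1}. u + l *\<^sub>R v \<in> U \<longrightarrow> has_directional_derivative Q 0 (u + l *\<^sub>R v) v))"

end

theory Submission
  imports Defs
begin

text \<open>Quasi-definiteness of the Jacobian makes \<open>Q\<close> monotone, i.e.
  \<open>(y - x) \<bullet> (Q y - Q x) \<ge> 0\<close>. By Minty's trick the level sets of a continuous monotone map are
  convex: if \<open>Q a = Q b = c\<close> and \<open>z\<close> lies between \<open>a\<close> and \<open>b\<close>, then averaging the inequalities at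
  \<open>a\<close> and \<open>b\<close> gives \<open>(x - z) \<bullet> (Q x - c) \<ge> 0\<close> for all \<open>x\<close>, and letting \<open>x \<rightarrow> z\<close> along every ray
  forces \<open>Q z = c\<close>. A failure of injectivity therefore yields a nondegenerate segment on which
  \<open>Q\<close> is constant, which violates each of the four conditions at one of its endpoints.\<close>

definition monotone_map_on :: "'a::real_inner set \<Rightarrow> ('a \<Rightarrow> 'a) \<Rightarrow> bool" where
  "monotone_map_on U Q \<longleftrightarrow> (\<forall>x\<in>U. \<forall>y\<in>U. 0 \<le> (y - x) \<bullet> (Q y - Q x))"

text \<open>A quadratic form cannot tell a matrix from its transpose, so the form of the symmetrized
  matrix is that of \<open>B\<close> itself. This removes the transpose from all later
  arguments.\<close>

lemma weakly_quasi_definite_iff: "weakly_quasi_definite B \<longleftrightarrow> (\<forall>l. 0 \<le> l \<bullet> (B *v l))"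
proof -
  have "l \<bullet> (((1/2) *\<^sub>R (B + transpose B)) *v l) = l \<bullet> (B *v l)" for l
  proof -
    have "l \<bullet> (transpose B *v l) = l \<bullet> (B *v l)"
      by (metis dot_lmul_matrix inner_commute transpose_matrix_vector)
    then show ?thesis
      by (simp add: scaleR_matrix_vector_assoc [symmetric] matrix_vector_mult_add_rdistrib
          inner_add_right)
  qed
  then show ?thesis
    by (simp add: weakly_quasi_definite_def)
qed

lemma line_in_closed_segment:
  assumes "0 \<le> t" "t \<le> 1"
  shows "a + t *\<^sub>R (b - a) \<in> closed_segment a b"
proof -
  have "a + t *\<^sub>R (b - a) = (1 - t) *\<^sub>R a + t *\<^sub>R b"
    by (simp add: algebra_simps)
  with assms show ?thesis
    unfolding in_segment by blast
qed

lemma has_vector_derivative_along_line: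
  fixes Q :: "'a::real_normed_vector \<Rightarrow> 'b::real_normed_vector"
  assumes "(Q has_derivative D) (at (u + t *\<^sub>R v))"
  shows "((\<lambda>t. Q (u + t *\<^sub>R v)) has_vector_derivative D v) (at t)"
proof -
  have "((\<lambda>t. u + t *\<^sub>R v) has_derivative (\<lambda>s. s *\<^sub>R v)) (at t)"
    by (auto intro!: derivative_eq_intros)
  from has_derivative_compose [OF this assms] show ?thesis
    by (simp add: has_vector_derivative_def
        linear_cmul [OF has_derivative_linear [OF assms]])
qed

text \<open>Pairing \<open>Q\<close> along the line from \<open>x\<close> to \<open>y\<close> with
  the direction \<open>y - x\<close> gives a real function whose derivative is the quadratic form of
  the Jacobian at \<open>y - x\<close>. It is therefore nondecreasing, and its values at 0 and 1 are
  compared.\<close>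

lemma weakly_quasi_definite_imp_monotone_map_on:
  fixes U :: "(real^'k) set" and Q :: "real^'k \<Rightarrow> real^'k"
  assumes "convex U"
    and diff: "\<And>u. u \<in> U \<Longrightarrow> Q differentiable (at u)"
    and wqd: "\<And>u. u \<in> U \<Longrightarrow> weakly_quasi_definite (jacobian Q (at u))"
  shows "monotone_map_on U Q"
  unfolding monotone_map_on_def
proof (intro ballI)
  fix x y assume "x \<in> U" "y \<in> U"
  let ?g = "\<lambda>t. (y - x) \<bullet> Q (x + t *\<^sub>R (y - x))"
  have "?g 0 \<le> ?g 1"
  proof (rule DERIV_nonneg_imp_nondecreasing [where f = ?g])
    fix t :: real assume t: "0 \<le> t" "t \<le> 1"
    let ?w = "x + t *\<^sub>R (y - x)"
    have "?w = (1 - t) *\<^sub>R x + t *\<^sub>R y"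
      by (simp add: algebra_simps)
    then have w: "?w \<in> U"
      using \<open>convex U\<close> \<open>x \<in> U\<close> \<open>y \<in> U\<close> t by (simp add: convex_alt)
    let ?d = "jacobian Q (at ?w) *v (y - x)"
    have "(Q has_derivative (*v) (jacobian Q (at ?w))) (at ?w)"
      using diff [OF w] by (simp add: jacobian_works)
    from bounded_linear.has_vector_derivative
        [OF bounded_linear_inner_right has_vector_derivative_along_line [OF this]]
    have "(?g has_real_derivative (y - x) \<bullet> ?d) (at t)"
      by (simp add: has_real_derivative_iff_has_vector_derivative)
    moreover have "0 \<le> (y - x) \<bullet> ?d"
      using wqd [OF w] by (simp add: weakly_quasi_definite_iff)
    ultimately show "\<exists>D. (?g has_real_derivative D) (at t) \<and> 0 \<le> D"
      by blast
  qed simp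
  then show "0 \<le> (y - x) \<bullet> (Q y - Q x)"
    by (simp add: inner_diff_right)
qed

lemma monotone_map_on_constant_on_segment:
  fixes Q :: "'a::real_inner \<Rightarrow> 'a"
  assumes mono: "monotone_map_on U Q" and "open U" "convex U" "continuous_on U Q"
    and ab: "a \<in> U" "b \<in> U" "Q a = Q b" and z: "z \<in> closed_segment a b"
  shows "Q z = Q a"
proof -
  obtain s where s: "0 \<le> s" "s \<le> 1" "z = (1 - s) *\<^sub>R a + s *\<^sub>R b"
    using z by (auto simp: closed_segment_def)
  have "z \<in> U"
    using closed_segment_subset [OF ab(1,2) \<open>convex U\<close>] z by blast
  \<comment> \<open>Since \<open>Q a = Q b\<close>, the monotonicity inequalities at
    \<open>a\<close> and at \<open>b\<close> share the factor \<open>Q x - Q a\<close>, so they can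
    be averaged with the weights that express \<open>z\<close>.\<close>
  have minty: "0 \<le> (x - z) \<bullet> (Q x - Q a)" if "x \<in> U" for x
  proof -
    have "0 \<le> (x - a) \<bullet> (Q x - Q a)" "0 \<le> (x - b) \<bullet> (Q x - Q a)"
      using mono ab that by (auto simp: monotone_map_on_def)
    then have "0 \<le> (1 - s) * ((x - a) \<bullet> (Q x - Q a)) + s * ((x - b) \<bullet> (Q x - Q a))"
      using s by simp
    also have "\<dots> = ((1 - s) *\<^sub>R (x - a) + s *\<^sub>R (x - b)) \<bullet> (Q x - Q a)"
      by (simp add: inner_add_left)
    also have "(1 - s) *\<^sub>R (x - a) + s *\<^sub>R (x - b) = x - z"
      by (simp add: s algebra_simps)
    finally show ?thesis .
  qed
  \<comment> \<open>Apply \<open>minty\<close> at \<open>z + t *\<^sub>R w\<close>, which lies in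
    \<open>U\<close> for small \<open>t > 0\<close>, cancel the factor \<open>t\<close>, and let
    \<open>t\<close> tend to 0.\<close>
  have "0 \<le> w \<bullet> (Q z - Q a)" for w
  proof (rule tendsto_lowerbound)
    have line: "((\<lambda>t. z + t *\<^sub>R w) \<longlongrightarrow> z) (at_right 0)"
      by (auto intro!: tendsto_eq_intros)
    have "isCont Q z"
      using \<open>continuous_on U Q\<close> \<open>open U\<close> \<open>z \<in> U\<close> by (simp add: continuous_on_eq_continuous_at)
    then show "((\<lambda>t. w \<bullet> (Q (z + t *\<^sub>R w) - Q a)) \<longlongrightarrow> w \<bullet> (Q z - Q a)) (at_right (0::real))"
      by (intro tendsto_intros isCont_tendsto_compose [OF _ line])
    have "\<forall>\<^sub>F t in at_right 0. z + t *\<^sub>R w \<in> U"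
      by (rule topological_tendstoD [OF line \<open>open U\<close> \<open>z \<in> U\<close>])
    then show "\<forall>\<^sub>F t in at_right 0. 0 \<le> w \<bullet> (Q (z + t *\<^sub>R w) - Q a)"
      using eventually_at_right_less
    proof eventually_elim
      case (elim t)
      then show ?case
        using minty [of "z + t *\<^sub>R w"] by (simp add: zero_le_mult_iff)
    qed
  qed simp
  \<comment> \<open>This choice of \<open>w\<close> turns the inequality into a bound on a squared
    norm.\<close>
  from this [of "- (Q z - Q a)"] have "(Q z - Q a) \<bullet> (Q z - Q a) \<le> 0"
    by (simp only: inner_minus_left neg_0_le_iff_le)
  then show ?thesis
    by (simp add: dot_square_norm)
qed

lemma has_directional_derivative_unique:
  assumes "has_directional_derivative Q d w v" "has_directional_derivative Q d' w v"
  shows "d = d'"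
  using assms unfolding has_directional_derivative_def
  by (intro tendsto_unique [OF trivial_limit_at_right_real])

lemma has_derivative_imp_has_directional_derivative:
  assumes "(Q has_derivative D) (at w)"
  shows "has_directional_derivative Q (D v) w v"
proof -
  have "((\<lambda>t. Q (w + t *\<^sub>R v)) has_vector_derivative D v) (at 0)"
    using assms by (intro has_vector_derivative_along_line) simp
  then have "((\<lambda>t. Q (w + t *\<^sub>R v)) has_vector_derivative D v) (at_right 0)"
    by (rule has_vector_derivative_at_within)
  then have "((\<lambda>t. (Q (w + t *\<^sub>R v) - Q w - t *\<^sub>R D v) /\<^sub>R norm t) \<longlongrightarrow> 0) (at_right 0)"
    by (simp add: has_vector_derivative_def has_derivative_at_within)
  \<comment> \<open>To the right of 0, \<open>norm t\<close> is \<open>t\<close>, so the remainder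
    quotient is the difference quotient minus \<open>D v\<close>.\<close>
  moreover have "\<forall>\<^sub>F t in at_right 0. (Q (w + t *\<^sub>R v) - Q w - t *\<^sub>R D v) /\<^sub>R norm t
      = (Q (w + t *\<^sub>R v) - Q w) /\<^sub>R t - D v"
    using eventually_at_right_less by eventually_elim (simp add: scaleR_diff_right)
  ultimately have "((\<lambda>t. (Q (w + t *\<^sub>R v) - Q w) /\<^sub>R t - D v) \<longlongrightarrow> 0) (at_right 0)"
    by (rule Lim_transform_eventually)
  then show ?thesis
    by (simp add: has_directional_derivative_def LIM_zero_iff)
qed

text \<open>The limit is one-sided, so only points ahead of \<open>w\<close> matter: the difference
  quotient vanishes for all \<open>t\<close> between 0 and \<open>e\<close>.\<close>

lemma has_directional_derivative_zero_if_constant_on_segment: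
  assumes "Q constant_on closed_segment w (w + e *\<^sub>R v)" and "0 < e"
  shows "has_directional_derivative Q 0 w v"
  unfolding has_directional_derivative_def
proof (rule tendsto_eventually)
  have const: "Q (w + t *\<^sub>R v) = Q w" if "0 < t" "t < e" for t
  proof -
    have "w + t *\<^sub>R v \<in> closed_segment w (w + e *\<^sub>R v)"
      using that line_in_closed_segment [of "t / e" w "w + e *\<^sub>R v"] by simp
    then show ?thesis
      using assms(1) by (auto simp: constant_on_def)
  qed
  have "\<forall>\<^sub>F t in at_right 0. t \<in> {0<..<e}"
    using \<open>0 < e\<close> by (intro eventually_at_rightI) auto
  then show "\<forall>\<^sub>F t in at_right 0. (Q (w + t *\<^sub>R v) - Q w) /\<^sub>R t = 0"
    by eventually_elim (simp add: const)
qed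

text \<open>A null direction makes the restriction of \<open>Q\<close> to the ray from
  \<open>u\<close> along \<open>v\<close> have zero derivative, so \<open>Q\<close> is constant on
  an initial piece of that ray inside \<open>U\<close>.\<close>

lemma null_direction_imp_not_inj_on:
  fixes U :: "(real^'k) set" and Q :: "real^'k \<Rightarrow> real^'k"
  assumes "open U" "u \<in> U" "v \<noteq> 0"
    and diff: "\<And>u. u \<in> U \<Longrightarrow> Q differentiable (at u)"
    and null: "\<And>l. \<lbrakk>0 \<le> l; l \<le> 1; u + l *\<^sub>R v \<in> U\<rbrakk> \<Longrightarrow>
                 has_directional_derivative Q 0 (u + l *\<^sub>R v) v"
  shows "\<not> inj_on Q U"
proof
  assume inj: "inj_on Q U"
  obtain e where e: "0 < e" "ball u e \<subseteq> U"
    using \<open>open U\<close> \<open>u \<in> U\<close> by (auto simp: open_contains_ball)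
  \<comment> \<open>The bound 1 keeps parameters within the range of \<open>null\<close>; the other
    bound, halved for strictness, keeps the points in the ball.\<close>
  define d where "d = min 1 (e / (2 * norm v))"
  have d: "0 < d" "d \<le> 1" "d * norm v < e"
    using \<open>v \<noteq> 0\<close> e(1) by (auto simp: d_def min_def field_simps)
  have inU: "u + t *\<^sub>R v \<in> U" if "0 \<le> t" "t \<le> d" for t
  proof -
    have "t * norm v < e"
      using mult_right_mono [OF that(2) norm_ge_zero [of v]] d(3) by linarith
    then show ?thesis
      using e(2) that by (auto simp: subset_iff dist_norm)
  qed
  have "((\<lambda>t. Q (u + t *\<^sub>R v)) has_derivative (\<lambda>h. 0)) (at t within {0..d})" if "t \<in> {0..d}" for t
  proof -
    have U: "u + t *\<^sub>R v \<in> U"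
      using inU that by simp
    obtain D where D: "(Q has_derivative D) (at (u + t *\<^sub>R v))"
      using diff [OF U] by (auto simp: differentiable_def)
    \<comment> \<open>The hypothesis gives only a one-sided limit; differentiability identifies it
      with \<open>D v\<close>, so the two-sided derivative along the line is zero.\<close>
    have "has_directional_derivative Q 0 (u + t *\<^sub>R v) v"
      using null U that d(2) by simp
    then have "D v = 0"
      using has_derivative_imp_has_directional_derivative [OF D]
      by (blast intro: has_directional_derivative_unique)
    with has_vector_derivative_along_line [OF D] show ?thesis
      by (simp add: has_vector_derivative_def has_derivative_at_withinI)
  qed
  from has_derivative_zero_constant [OF _ this]
  obtain c where c: "\<And>t. t \<in> {0..d} \<Longrightarrow> Q (u + t *\<^sub>R v) = c"
    by auto
  have "Q u = Q (u + d *\<^sub>R v)"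
    using c [of 0] c [of d] d(1) by simp
  with inj have "u = u + d *\<^sub>R v"
    by (rule inj_onD) (use \<open>u \<in> U\<close> inU d(1) in auto)
  then show False
    using d(1) \<open>v \<noteq> 0\<close> by simp
qed

text \<open>Every neighborhood of the endpoint \<open>a\<close> contains other points of the
  segment, and these share the value \<open>Q a\<close>.\<close>

lemma constant_segment_imp_not_locally_injective_at:
  assumes "Q constant_on closed_segment a b" "a \<noteq> b"
  shows "\<not> locally_injective_at U Q a"
proof
  assume "locally_injective_at U Q a"
  then obtain N where N: "a \<in> interior N" "inj_on Q N"
    by (auto simp: locally_injective_at_def)
  have "((\<lambda>t. a + t *\<^sub>R (b - a)) \<longlongrightarrow> a) (at_right (0::real))"
    by (auto intro!: tendsto_eq_intros)
  then have "\<forall>\<^sub>F t in at_right (0::real). a + t *\<^sub>R (b - a) \<in> interior N"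
    using N(1) by (intro topological_tendstoD) auto
  moreover have "\<forall>\<^sub>F t in at_right (0::real). t \<in> {0<..<1}"
    by (intro eventually_at_rightI) auto
  ultimately have "\<forall>\<^sub>F t in at_right (0::real). a + t *\<^sub>R (b - a) \<in> interior N \<and> t \<in> {0<..<1}"
    by (rule eventually_conj)
  then obtain t :: real where t: "a + t *\<^sub>R (b - a) \<in> interior N" "0 < t" "t < 1"
    using eventually_happens' [OF trivial_limit_at_right_real] by fastforce
  have "a + t *\<^sub>R (b - a) \<in> closed_segment a b"
    using t by (intro line_in_closed_segment) auto
  then have "Q a = Q (a + t *\<^sub>R (b - a))"
    using assms(1) by (auto simp: constant_on_def)
  then have "a = a + t *\<^sub>R (b - a)"
    using N t(1) interior_subset [of N] by (auto dest: inj_onD)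
  then show False
    using t(2) \<open>a \<noteq> b\<close> by simp
qed

theorem corollary3:
  fixes U :: "(real^'k) set" and Q :: "real^'k \<Rightarrow> real^'k"
  assumes "open U" and "convex U"
    and "\<And>u. u \<in> U \<Longrightarrow> Q differentiable (at u)"
    and "\<And>u. u \<in> U \<Longrightarrow> weakly_quasi_definite (jacobian Q (at u))"
  shows "(inj_on Q U \<longleftrightarrow> (\<forall>u\<in>U. uniquely_attained_at U Q u)) \<and>
         (inj_on Q U \<longleftrightarrow> (\<forall>u\<in>U. locally_injective_at U Q u)) \<and>
         (inj_on Q U \<longleftrightarrow> (\<forall>u\<in>U. no_constant_segment_at U Q u)) \<and>
         (inj_on Q U \<longleftrightarrow> (\<forall>u\<in>U. no_null_direction_at U Q u))"
proof -
  have "continuous_on U Q"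
    by (intro continuous_at_imp_continuous_on ballI differentiable_imp_continuous_within assms(3))
  have "monotone_map_on U Q"
    using assms(2-4) by (rule weakly_quasi_definite_imp_monotone_map_on)
  have const: "Q constant_on closed_segment a b" if "a \<in> U" "b \<in> U" "Q a = Q b" for a b
    unfolding constant_on_def
    using monotone_map_on_constant_on_segment
        [OF \<open>monotone_map_on U Q\<close> assms(1,2) \<open>continuous_on U Q\<close> that]
    by blast
  have a: "inj_on Q U \<longleftrightarrow> (\<forall>u\<in>U. uniquely_attained_at U Q u)"
    by (auto simp: inj_on_def uniquely_attained_at_def)
  \<comment> \<open>Forwards, the open set \<open>U\<close> itself serves as the neighborhood.
    Backwards, two distinct points with equal values span a constant segment, and local injectivity
    fails at its first endpoint.\<close>
  have b: "inj_on Q U \<longleftrightarrow> (\<forall>u\<in>U. locally_injective_at U Q u)"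
  proof
    assume "inj_on Q U"
    with \<open>open U\<close> show "\<forall>u\<in>U. locally_injective_at U Q u"
      by (auto simp: locally_injective_at_def interior_open)
  next
    assume "\<forall>u\<in>U. locally_injective_at U Q u"
    then show "inj_on Q U"
      using const constant_segment_imp_not_locally_injective_at by (blast intro: inj_onI)
  qed
  have c: "inj_on Q U \<longleftrightarrow> (\<forall>u\<in>U. no_constant_segment_at U Q u)"
  proof
    assume inj: "inj_on Q U"
    show "\<forall>u\<in>U. no_constant_segment_at U Q u"
      unfolding no_constant_segment_at_def
    proof (intro ballI allI impI, elim conjE)
      fix u a b
      assume "u \<in> U" and seg: "closed_segment a b \<subseteq> U" "u \<in> closed_segment a b"
        "Q constant_on closed_segment a b"
      have "x = u" if "x \<in> closed_segment a b" for x
      proof (rule inj_onD [OF inj])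
        show "Q x = Q u"
          using seg(2,3) that by (auto simp: constant_on_def)
      qed (use seg that in auto)
      with seg(2) show "closed_segment a b = {u}"
        by blast
    qed
  next
    assume none: "\<forall>u\<in>U. no_constant_segment_at U Q u"
    show "inj_on Q U"
    proof (rule inj_onI)
      fix x y assume xy: "x \<in> U" "y \<in> U" "Q x = Q y"
      \<comment> \<open>The segment lies in \<open>U\<close> by convexity and \<open>Q\<close> is
        constant on it, so the condition at the endpoint \<open>x\<close> collapses it.\<close>
      have "closed_segment x y = {x}"
        using none \<open>x \<in> U\<close> const [OF xy] closed_segment_subset [OF xy(1,2) \<open>convex U\<close>]
          ends_in_segment(1) [of x y]
        unfolding no_constant_segment_at_def by blast
      then show "x = y"
        using ends_in_segment(2) [of y x] by (metis singletonD)
    qed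
  qed
  have d: "inj_on Q U \<longleftrightarrow> (\<forall>u\<in>U. no_null_direction_at U Q u)"
  proof
    assume "inj_on Q U"
    then show "\<forall>u\<in>U. no_null_direction_at U Q u"
      unfolding no_null_direction_at_def
      using null_direction_imp_not_inj_on [OF \<open>open U\<close> _ _ assms(3)]
      by (meson atLeastAtMost_iff)
  next
    assume none: "\<forall>u\<in>U. no_null_direction_at U Q u"
    show "inj_on Q U"
    proof (rule inj_onI, rule ccontr)
      fix x y assume xy: "x \<in> U" "y \<in> U" "Q x = Q y" and "x \<noteq> y"
      \<comment> \<open>Only half of the segment is used: at \<open>y\<close> itself the one-sided derivative in direction
        \<open>y - x\<close> looks outside the segment.\<close>
      let ?v = "(1 / 2) *\<^sub>R (y - x)"
      have "has_directional_derivative Q 0 (x + l *\<^sub>R ?v) ?v" if "l \<in> {0..1}" for l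
      proof (rule has_directional_derivative_zero_if_constant_on_segment)
        \<comment> \<open>One further step \<open>?v\<close> moves the fraction along the segment
          from \<open>l / 2\<close> to \<open>(l + 1) / 2\<close>, which is at most 1. So the piece
          ahead of each point, taken with \<open>e = 1\<close>, stays where \<open>Q\<close> is
          constant.\<close>
        have "x + (l / 2) *\<^sub>R (y - x) \<in> closed_segment x y"
          and "x + ((l + 1) / 2) *\<^sub>R (y - x) \<in> closed_segment x y"
          using that by (auto intro!: line_in_closed_segment)
        moreover have "x + l *\<^sub>R ?v = x + (l / 2) *\<^sub>R (y - x)"
          and "x + l *\<^sub>R ?v + 1 *\<^sub>R ?v = x + ((l + 1) / 2) *\<^sub>R (y - x)"
          by (simp_all add: add_divide_distrib scaleR_add_left)
        ultimately have "closed_segment (x + l *\<^sub>R ?v) (x + l *\<^sub>R ?v + 1 *\<^sub>R ?v) \<subseteq> closed_segment x y"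
          by (simp only: subset_closed_segment)
        then show "Q constant_on closed_segment (x + l *\<^sub>R ?v) (x + l *\<^sub>R ?v + 1 *\<^sub>R ?v)"
          by (rule constant_on_subset [OF const [OF xy]])
      qed simp
      moreover have "?v \<noteq> 0"
        using \<open>x \<noteq> y\<close> by simp
      ultimately show False
        using none \<open>x \<in> U\<close> unfolding no_null_direction_at_def by blast
    qed
  qed
  from a b c d show ?thesis
    by blast
qed

end
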